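(* Let $(X,d)$ be a complete metric space which is nearly uniformly convex. Then $(X,d)$ is reflexive.
   Context: A midpoint of $x,y\in X$ is a point $m$ with $d(x,m)=d(y,m)=\frac12 d(x,y)$. $(X,d)$ admits midpoints if every pair of points has a midpoint; a complete metric space admitting midpoints is geodesic. A complete metric space admitting midpoints is $\infty$-convex if $d(m,z)\le\max\{d(x,z),d(y,z)\}$ for all $x,y,z\in X$ and every midpoint $m$ of $x$ and $y$. A subset $C\subset X$ is convex if for all $x,y\in C$ every geodesic connecting $x$ and $y$ is contained in $C$. For $A\subset X$ put $G_0=A$ and let $G_n$ be the union of all geodesics connecting two points of $G_{n-1}$; the convex hull is $\operatorname{conv}A=\bigcup_{n}G_n$, and $\overline{\operatorname{conv}A}$ is its closure. A family $(x_i)_{i\in I}$ is $\epsilon$-separated if $d(x_i,x_j)\ge\epsilon$ for all $i\neq j$. An $\infty$-convex space is nearly uniformly convex if for every $R>0$ and $\epsilon>0$ there is $\rho=\rho(\epsilon,R)>0$ such that for every $y\in X$, every $r\le R$ and every infinite $\epsilon$-separated family $(x_i)_{i\in I}$ with $d(x_i,y)\le r$ for all $i$, one has $B_{(1-\rho)r}(y)\cap\overline{\operatorname{conv}(x_i)_{i\in I}}\neq\varnothing$, where $B_s(y)$ denotes the closed ball of radius $s$ around $y$. $(X,d)$ is reflexive if for every directed set $I$ and every decreasing family $(C_i)_{i\in I}$ of non-empty bounded closed convex subsets (i.e. $C_i\subset C_j$ whenever $i>j$) one has $\bigcap_{i\in I}C_i\ne\varnothing$. *)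

theory Defs
  imports "HOL-Analysis.Analysis"
begin

definition is_midpoint :: "'a::metric_space \<Rightarrow> 'a \<Rightarrow> 'a \<Rightarrow> bool" where
  "is_midpoint m x y \<longleftrightarrow> dist x m = dist x y / 2 \<and> dist y m = dist x y / 2"

definition admits_midpoints :: "'a::metric_space itself \<Rightarrow> bool" where
  "admits_midpoints TYPE('a) \<longleftrightarrow> (\<forall>x y::'a. \<exists>m. is_midpoint m x y)"

definition infinity_convex :: "'a::complete_space itself \<Rightarrow> bool" where
  "infinity_convex TYPE('a) \<longleftrightarrow> admits_midpoints TYPE('a) \<and>
     (\<forall>x y z m::'a. is_midpoint m x y \<longrightarrow> dist m z \<le> max (dist x z) (dist y z))"

text \<open>Geodesics are minimal and parametrized with constant speed on the unit interval;
  the values of the map outside that interval are irrelevant.\<close>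

definition geodesic :: "(real \<Rightarrow> 'a::metric_space) \<Rightarrow> 'a \<Rightarrow> 'a \<Rightarrow> bool" where
  "geodesic \<gamma> x y \<longleftrightarrow> \<gamma> 0 = x \<and> \<gamma> 1 = y \<and>
     (\<forall>s\<in>{0..1}. \<forall>t\<in>{0..1}. dist (\<gamma> s) (\<gamma> t) = \<bar>s - t\<bar> * dist x y)"

definition geodesically_convex :: "'a::metric_space set \<Rightarrow> bool" where
  "geodesically_convex C \<longleftrightarrow>
     (\<forall>x\<in>C. \<forall>y\<in>C. \<forall>\<gamma>. geodesic \<gamma> x y \<longrightarrow> \<gamma> ` {0..1} \<subseteq> C)"

primrec geodesic_hull_step :: "'a::metric_space set \<Rightarrow> nat \<Rightarrow> 'a set" where
  "geodesic_hull_step A 0 = A"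
| "geodesic_hull_step A (Suc n) =
     \<Union>{\<gamma> ` {0..1} |\<gamma> x y. x \<in> geodesic_hull_step A n \<and> y \<in> geodesic_hull_step A n \<and> geodesic \<gamma> x y}"

definition geodesic_hull :: "'a::metric_space set \<Rightarrow> 'a set" where
  "geodesic_hull A = (\<Union>n. geodesic_hull_step A n)"

definition separated_family :: "real \<Rightarrow> 'i set \<Rightarrow> ('i \<Rightarrow> 'a::metric_space) \<Rightarrow> bool" where
  "separated_family \<epsilon> I x \<longleftrightarrow> (\<forall>i\<in>I. \<forall>j\<in>I. i \<noteq> j \<longrightarrow> dist (x i) (x j) \<ge> \<epsilon>)"

text \<open>The families range over index sets taken from the space itself. This is no restriction:
  a separated family is injective, so it can be indexed by its own image. The lemma
  after the definition gives the property for an arbitrary index type.\<close>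

definition nearly_uniformly_convex :: "'a::complete_space itself \<Rightarrow> bool" where
  "nearly_uniformly_convex TYPE('a) \<longleftrightarrow> infinity_convex TYPE('a) \<and>
     (\<forall>R>0. \<forall>\<epsilon>>0. \<exists>\<rho>>0. \<forall>(y::'a) r (I::'a set) (x::'a \<Rightarrow> 'a).
        r \<le> R \<longrightarrow> infinite I \<longrightarrow> separated_family \<epsilon> I x \<longrightarrow> (\<forall>i\<in>I. dist (x i) y \<le> r) \<longrightarrow>
        cball y ((1 - \<rho>) * r) \<inter> closure (geodesic_hull (x ` I)) \<noteq> {})"

lemma nearly_uniformly_convex_family:
  assumes "nearly_uniformly_convex TYPE('a::complete_space)" "R > 0" "\<epsilon> > 0"
  shows "\<exists>\<rho>>0. \<forall>(y::'a) r (I::'i set) x.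
        r \<le> R \<longrightarrow> infinite I \<longrightarrow> separated_family \<epsilon> I x \<longrightarrow> (\<forall>i\<in>I. dist (x i) y \<le> r) \<longrightarrow>
        cball y ((1 - \<rho>) * r) \<inter> closure (geodesic_hull (x ` I)) \<noteq> {}"
proof -
  obtain \<rho> where "\<rho> > 0" and \<rho>: "\<And>(y::'a) r (I::'a set) (x::'a \<Rightarrow> 'a).
        r \<le> R \<Longrightarrow> infinite I \<Longrightarrow> separated_family \<epsilon> I x \<Longrightarrow> (\<forall>i\<in>I. dist (x i) y \<le> r) \<Longrightarrow>
        cball y ((1 - \<rho>) * r) \<inter> closure (geodesic_hull (x ` I)) \<noteq> {}"
    using assms unfolding nearly_uniformly_convex_def by metis
  have "cball y ((1 - \<rho>) * r) \<inter> closure (geodesic_hull (x ` I)) \<noteq> {}"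
    if "r \<le> R" "infinite I" "separated_family \<epsilon> I x" "\<forall>i\<in>I. dist (x i) y \<le> r"
    for y :: 'a and r and I :: "'i set" and x
  proof -
    have "inj_on x I"
      using that(3) \<open>\<epsilon> > 0\<close> by (force simp: inj_on_def separated_family_def)
    then have "infinite (x ` I)"
      using that(2) finite_imageD by blast
    moreover have "separated_family \<epsilon> (x ` I) (\<lambda>z. z)"
      using that(3) by (auto simp: separated_family_def)
    ultimately show ?thesis
      using \<rho>[of r "x ` I" "\<lambda>z. z" y] that by simp
  qed
  with \<open>\<rho> > 0\<close> show ?thesis by blast
qed

definition directed_set :: "'i set \<Rightarrow> ('i \<Rightarrow> 'i \<Rightarrow> bool) \<Rightarrow> bool" where
  "directed_set I le \<longleftrightarrow> I \<noteq> {} \<and> reflp_on I le \<and> transp_on I le \<and>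
     (\<forall>i\<in>I. \<forall>j\<in>I. \<exists>k\<in>I. le i k \<and> le j k)"

text \<open>HOL cannot quantify over types inside a definition, so the type from which the directed
  index sets are taken is a parameter. A theorem whose conclusion is this predicate for a
  type variable \<open>'i\<close> covers all directed sets. Monotonicity is required
  along the reflexive relation, so that indices equivalent in a directed preorder
  carry the same set.\<close>

definition reflexive_space :: "'i itself \<Rightarrow> 'a::metric_space itself \<Rightarrow> bool" where
  "reflexive_space TYPE('i) TYPE('a) \<longleftrightarrow>
     (\<forall>(I::'i set) le (C::'i \<Rightarrow> 'a set).
        directed_set I le \<longrightarrow>
        (\<forall>i\<in>I. C i \<noteq> {} \<and> bounded (C i) \<and> closed (C i) \<and> geodesically_convex (C i)) \<longrightarrow>
        (\<forall>i\<in>I. \<forall>j\<in>I. le j i \<longrightarrow> C i \<subseteq> C j) \<longrightarrow>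
        (\<Inter>i\<in>I. C i) \<noteq> {})"

end

theory Submission
  imports Defs
begin

text \<open>Fix a point \<open>y\<close> and let \<open>r\<close> be the supremum of its distances to the sets \<open>C i\<close>. If \<open>r > 0\<close>,
  then an \<open>\<epsilon>\<close>-separated sequence in \<open>C i \<inter> cball y s\<close>, with \<open>s\<close> slightly above \<open>r\<close>, would by near
  uniform convexity force \<open>infdist y (C i) \<le> (1 - \<rho>) * s\<close>, which fails for large \<open>i\<close>. Hence the
  truncated sets \<open>C i \<inter> cball y s\<close> have arbitrarily small measure of noncompactness, and their
  intersection is non-empty by Kuratowski's form of Cantor's intersection theorem.\<close>

lemma geodesic_hull_subset:
  assumes "A \<subseteq> C" "geodesically_convex C"
  shows "geodesic_hull A \<subseteq> C"
proof -
  have "geodesic_hull_step A n \<subseteq> C" for n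
  proof (induction n)
    case (Suc n)
    then show ?case
      using assms(2) unfolding geodesically_convex_def by (simp add: subset_iff) blast
  qed (use assms in simp)
  then show ?thesis
    by (auto simp: geodesic_hull_def)
qed

text \<open>Greedy choice: if no finitely many \<open>e\<close>-balls cover \<open>S\<close>, the
  balls around the points chosen so far miss a point of \<open>S\<close>, and that point is the next
  term.\<close>

lemma separated_sequence_or_finite_cover:
  fixes S :: "'a::metric_space set"
  obtains x :: "nat \<Rightarrow> 'a" where "range x \<subseteq> S" "separated_family e UNIV x"
  | k where "finite k" "S \<subseteq> (\<Union>c\<in>k. ball c e)"
proof (cases "\<exists>k. finite k \<and> S \<subseteq> (\<Union>c\<in>k. ball c e)")
  case False
  have "\<exists>x. \<forall>n::nat. x n \<in> S \<and> (\<forall>m<n. e \<le> dist (x m) (x n))"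
  proof (rule dependent_wellorder_choice)
    fix n :: nat and x :: "nat \<Rightarrow> 'a"
    have "\<not> S \<subseteq> (\<Union>c\<in>x ` {..<n}. ball c e)"
      using False by blast
    then show "\<exists>z. z \<in> S \<and> (\<forall>m<n. e \<le> dist (x m) z)"
      by (fastforce simp: not_less)
  qed simp
  then obtain x :: "nat \<Rightarrow> 'a" where x: "\<And>n. x n \<in> S" "\<And>m n. m < n \<Longrightarrow> e \<le> dist (x m) (x n)"
    by blast
  have "separated_family e UNIV x"
    unfolding separated_family_def by (metis dist_commute linorder_neqE_nat x(2))
  with x(1) that(1) show ?thesis
    by blast
qed (use that in blast)

text \<open>Covering a tail suffices, because the finitely many earlier terms can be added as
  further centres. The closure of the range is thus totally bounded, and it is complete as a closed
  set.\<close>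

lemma compact_closure_range:
  fixes x :: "nat \<Rightarrow> 'a::complete_space"
  assumes "\<And>e. e > 0 \<Longrightarrow> \<exists>N k. finite k \<and> x ` {N..} \<subseteq> (\<Union>c\<in>k. ball c e)"
  shows "compact (closure (range x))"
  unfolding compact_eq_totally_bounded
proof (intro conjI allI impI)
  show "complete (closure (range x))"
    by (simp add: complete_eq_closed)
  fix e :: real
  assume "e > 0"
  \<comment> \<open>Half the radius leaves room to pass to closed balls: a finite union of these is
    closed, so it contains the closure, and it fits into open balls of radius
    \<open>e\<close>.\<close>
  then obtain N k where k: "finite k" "x ` {N..} \<subseteq> (\<Union>c\<in>k. ball c (e/2))"
    using assms[of "e/2"] by auto
  define k' where "k' = k \<union> x ` {..<N}"
  have "x n \<in> (\<Union>c\<in>k'. cball c (e/2))" for n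
  proof (cases "n < N")
    case True
    then have "x n \<in> k'"
      by (simp add: k'_def)
    then show ?thesis
      using \<open>e > 0\<close> by (intro UN_I) auto
  next
    case False
    then have "x n \<in> (\<Union>c\<in>k. ball c (e/2))"
      using k(2) by (simp add: image_subset_iff)
    then show ?thesis
      by (auto simp: k'_def intro: less_imp_le)
  qed
  moreover have "finite k'"
    using k(1) by (simp add: k'_def)
  ultimately have "closure (range x) \<subseteq> (\<Union>c\<in>k'. cball c (e/2))"
    by (intro closure_minimal closed_UN) auto
  also have "\<dots> \<subseteq> (\<Union>c\<in>k'. ball c e)"
    using \<open>e > 0\<close> by (intro UN_mono) auto
  finally show "\<exists>k. finite k \<and> closure (range x) \<subseteq> (\<Union>c\<in>k. ball c e)"
    using \<open>finite k'\<close> by blast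
qed

text \<open>Countably many members \<open>S n\<close> with ever finer finite covers intersect in a
  compact set \<open>K\<close>. Every member of \<open>F\<close> meets \<open>K\<close>, and every
  finite intersection of members contains a member, so compactness of \<open>K\<close> yields a
  common point.\<close>

theorem Kuratowski_intersection:
  fixes F :: "'a::complete_space set set"
  assumes closed: "\<And>A. A \<in> F \<Longrightarrow> closed A"
    and nonempty: "\<And>A. A \<in> F \<Longrightarrow> A \<noteq> {}"
    and directed: "\<And>A B. A \<in> F \<Longrightarrow> B \<in> F \<Longrightarrow> \<exists>C\<in>F. C \<subseteq> A \<inter> B"
    and small: "\<And>e. e > 0 \<Longrightarrow> \<exists>A\<in>F. \<exists>k. finite k \<and> A \<subseteq> (\<Union>c\<in>k. ball c e)"
  shows "\<Inter>F \<noteq> {}"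
proof -
  have "\<exists>A\<in>F. \<exists>k. finite k \<and> A \<subseteq> (\<Union>c\<in>k. ball c (inverse (Suc n)))" for n
    by (rule small) simp
  then obtain S where S: "\<And>n. S n \<in> F"
    "\<And>n. \<exists>k. finite k \<and> S n \<subseteq> (\<Union>c\<in>k. ball c (inverse (Suc n)))"
    by metis
  have fine: "\<exists>n k. finite k \<and> S n \<subseteq> (\<Union>c\<in>k. ball c e)" if "e > 0" for e
  proof -
    obtain n where n: "inverse (Suc n) < e"
      using reals_Archimedean \<open>e > 0\<close> by blast
    obtain k where k: "finite k" "S n \<subseteq> (\<Union>c\<in>k. ball c (inverse (Suc n)))"
      using S(2) by blast
    note k(2)
    also have "(\<Union>c\<in>k. ball c (inverse (Suc n))) \<subseteq> (\<Union>c\<in>k. ball c e)"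
      using n by (intro UN_mono subset_ball) simp_all
    finally show ?thesis
      using k(1) by blast
  qed
  define K where "K = (\<Inter>n. S n)"
  have "compact K"
    unfolding compact_eq_totally_bounded
  proof (intro conjI allI impI)
    show "complete K"
      using closed S(1) by (auto simp: K_def complete_eq_closed)
    show "\<exists>k. finite k \<and> K \<subseteq> (\<Union>c\<in>k. ball c e)" if "e > 0" for e
      using fine[OF that] unfolding K_def by blast
  qed
  \<comment> \<open>Directedness gives a decreasing sequence of members \<open>D n\<close> inside
    \<open>B \<inter> S n\<close>. Points \<open>x n\<close> picked from them have tails in each
    \<open>S n\<close>, so a subsequence converges, and its limit lies in every closed
    \<open>D n\<close>.\<close>
  have meets: "K \<inter> B \<noteq> {}" if "B \<in> F" for B
  proof -
    have "\<exists>D. \<forall>n. (D n \<in> F \<and> D n \<subseteq> B \<inter> S n) \<and> D (Suc n) \<subseteq> D n"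
    proof (rule dependent_nat_choice)
      show "\<exists>A. A \<in> F \<and> A \<subseteq> B \<inter> S 0"
        using directed[OF that S(1)] by blast
      show "\<exists>A'. (A' \<in> F \<and> A' \<subseteq> B \<inter> S (Suc n)) \<and> A' \<subseteq> A" if "A \<in> F \<and> A \<subseteq> B \<inter> S n" for A n
        using directed[of A "S (Suc n)"] that S(1) by blast
    qed
    then obtain D where D: "\<And>n. D n \<in> F" "\<And>n. D n \<subseteq> B \<inter> S n" "\<And>n. D (Suc n) \<subseteq> D n"
      by blast
    have "decseq D"
      using D(3) by (simp add: decseq_Suc_iff)
    have "\<forall>n. \<exists>z. z \<in> D n"
      using nonempty D(1) by blast
    then obtain x where x: "\<And>n. x n \<in> D n"
      by metis
    have tail: "x m \<in> D n" if "n \<le> m" for m n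
      using x[of m] decseqD[OF \<open>decseq D\<close> that] by blast
    have "compact (closure (range x))"
    proof (rule compact_closure_range)
      fix e :: real
      assume "e > 0"
      then obtain n k where "finite k" "S n \<subseteq> (\<Union>c\<in>k. ball c e)"
        using fine by blast
      moreover have "x ` {n..} \<subseteq> S n"
        using tail D(2) by fastforce
      ultimately show "\<exists>N k. finite k \<and> x ` {N..} \<subseteq> (\<Union>c\<in>k. ball c e)"
        by blast
    qed
    then obtain l and q :: "nat \<Rightarrow> nat" where q: "strict_mono q" "(x \<circ> q) \<longlonglongrightarrow> l"
      unfolding compact_eq_seq_compact_metric seq_compact_def
      by (metis closure_subset rangeI subsetD)
    have "l \<in> D n" for n
    proof (rule Lim_in_closed_set[OF closed[OF D(1)] _ _ q(2)])
      show "\<forall>\<^sub>F m in sequentially. (x \<circ> q) m \<in> D n"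
        unfolding eventually_sequentially
        using tail order_trans[OF _ seq_suble[OF q(1)]] by (intro exI[of _ n]) auto
    qed simp
    then show ?thesis
      using D(2) unfolding K_def by blast
  qed
  have lower: "\<exists>B\<in>F. B \<subseteq> \<Inter>G" if "finite G" "G \<subseteq> F" for G
    using that
  proof (induction G)
    case empty
    then show ?case
      using S(1) by auto
  next
    case (insert A G)
    then obtain B where B: "B \<in> F" "B \<subseteq> \<Inter>G"
      by auto
    obtain D where "D \<in> F" "D \<subseteq> A \<inter> B"
      using directed[of A B] insert.prems B(1) by auto
    with B(2) have "D \<subseteq> \<Inter>(insert A G)"
      by auto
    with \<open>D \<in> F\<close> show ?case
      by (rule bexI[rotated])
  qed
  have "K \<inter> \<Inter>F \<noteq> {}"
  proof (rule compact_imp_fip[OF \<open>compact K\<close> closed])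
    fix G
    assume "finite G" "G \<subseteq> F"
    then obtain B where "B \<in> F" "B \<subseteq> \<Inter>G"
      using lower by blast
    with meets[of B] show "K \<inter> \<Inter>G \<noteq> {}"
      by blast
  qed
  then show ?thesis
    by blast
qed

theorem theorem10:
  assumes "nearly_uniformly_convex TYPE('a::complete_space)"
  shows "reflexive_space TYPE('i) TYPE('a)"
  unfolding reflexive_space_def
proof (intro allI impI)
  fix I :: "'i set" and le and C :: "'i \<Rightarrow> 'a set"
  assume dir: "directed_set I le"
    and C: "\<forall>i\<in>I. C i \<noteq> {} \<and> bounded (C i) \<and> closed (C i) \<and> geodesically_convex (C i)"
    and mono: "\<forall>i\<in>I. \<forall>j\<in>I. le j i \<longrightarrow> C i \<subseteq> C j"
  have below: "\<exists>k\<in>I. C k \<subseteq> C i \<inter> C j" if "i \<in> I" "j \<in> I" for i j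
  proof -
    obtain k where "k \<in> I" "le i k" "le j k"
      using dir \<open>i \<in> I\<close> \<open>j \<in> I\<close> unfolding directed_set_def by blast
    with mono \<open>i \<in> I\<close> \<open>j \<in> I\<close> show ?thesis
      by (intro bexI[of _ k]) simp_all
  qed
  obtain i0 where i0: "i0 \<in> I"
    using dir by (auto simp: directed_set_def)
  \<comment> \<open>The goal does not mention \<open>y\<close>; an arbitrary point of the space
    serves as centre.\<close>
  fix y :: 'a
  obtain b where b: "\<And>z. z \<in> C i0 \<Longrightarrow> dist y z \<le> b"
    using C i0 bounded_any_center[of "C i0" y] by blast
  define d where "d i = infdist y (C i)" for i
  \<comment> \<open>Each \<open>C i\<close> shares a point with the bounded set \<open>C i0\<close>,
    since both contain some \<open>C k\<close>; hence \<open>b\<close> bounds all the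
    distances.\<close>
  have bdd: "bdd_above (d ` I)"
  proof (rule bdd_aboveI2)
    fix i
    assume "i \<in> I"
    then obtain k where "k \<in> I" "C k \<subseteq> C i \<inter> C i0"
      using below i0 by blast
    moreover obtain z where "z \<in> C k"
      using C \<open>k \<in> I\<close> by blast
    ultimately have "z \<in> C i" "z \<in> C i0"
      by auto
    then show "d i \<le> b"
      unfolding d_def using b[of z] infdist_le[of z "C i" y] by simp
  qed
  define r where "r = (SUP i\<in>I. d i)"
  have d_le: "d i \<le> r" if "i \<in> I" for i
    unfolding r_def using that bdd by (rule cSUP_upper)
  show "(\<Inter>i\<in>I. C i) \<noteq> {}"
  proof (cases "r > 0")
    case False
    have "y \<in> C i" if "i \<in> I" for i
    proof -
      have "infdist y (C i) = 0"
        using False d_le[OF that] infdist_nonneg[of y "C i"] by (simp add: d_def)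
      then show ?thesis
        using C that in_closed_iff_infdist_zero by blast
    qed
    then show ?thesis
      by blast
  next
    case True
    \<comment> \<open>Radii strictly above \<open>r\<close> keep the truncated sets non-empty even
      where the distance from \<open>y\<close> to \<open>C i\<close> is not attained.\<close>
    define F where "F = {C i \<inter> cball y s | i s. i \<in> I \<and> s > r}"
    have F_I: "C i \<inter> cball y s \<in> F" if "i \<in> I" "s > r" for i s
      using that unfolding F_def by blast
    have "\<Inter>F \<noteq> {}"
    proof (rule Kuratowski_intersection)
      show "closed A" if "A \<in> F" for A
        using that C by (auto simp: F_def)
      show "A \<noteq> {}" if "A \<in> F" for A
      proof -
        obtain i s where A: "A = C i \<inter> cball y s" "i \<in> I" "s > r"
          using \<open>A \<in> F\<close> by (auto simp: F_def)
        then have "infdist y (C i) < s"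
          using d_le[of i] by (simp add: d_def)
        then obtain z where "z \<in> C i" "dist y z < s"
          using C A(2) by (auto simp: infdist_def cINF_less_iff)
        then show ?thesis
          using A(1) by force
      qed
      show "\<exists>B\<in>F. B \<subseteq> A \<inter> A'" if AA': "A \<in> F" "A' \<in> F" for A A'
      proof -
        obtain i s j t where A: "A = C i \<inter> cball y s" "i \<in> I" "s > r"
          and A': "A' = C j \<inter> cball y t" "j \<in> I" "t > r"
          using AA' by (auto simp: F_def)
        obtain k where "k \<in> I" "C k \<subseteq> C i \<inter> C j"
          using below A(2) A'(2) by blast
        have "C k \<inter> cball y (min s t) \<in> F"
          using A(3) A'(3) \<open>k \<in> I\<close> by (simp add: F_I)
        moreover have "C k \<inter> cball y (min s t) \<subseteq> A \<inter> A'"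
          using A(1) A'(1) \<open>C k \<subseteq> C i \<inter> C j\<close> by auto
        ultimately show ?thesis
          by blast
      qed
      show "\<exists>A\<in>F. \<exists>k. finite k \<and> A \<subseteq> (\<Union>c\<in>k. ball c e)" if "e > 0" for e
      proof -
        obtain \<rho> where "\<rho> > 0" and \<rho>: "\<And>s (x :: nat \<Rightarrow> 'a). s \<le> 2 * r \<Longrightarrow> separated_family e UNIV x \<Longrightarrow>
            (\<forall>n. dist (x n) y \<le> s) \<Longrightarrow>
            cball y ((1 - \<rho>) * s) \<inter> closure (geodesic_hull (range x)) \<noteq> {}"
          using nearly_uniformly_convex_family[OF assms, of "2 * r" e, where 'i = nat] True \<open>e > 0\<close>
          by fastforce
        \<comment> \<open>For \<open>\<rho> < 1\<close> the product
          \<open>(1 - \<rho>) * (1 + \<rho>)\<close> is below 1; for \<open>\<rho> \<ge> 1\<close>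
          the factor \<open>1 - \<rho>\<close> is not positive. The cap at 1 keeps \<open>s\<close>
          within the bound \<open>2 * r\<close> for which \<open>\<rho>\<close> was chosen.\<close>
        define s where "s = r * (1 + min 1 \<rho>)"
        have s: "r < s" "s \<le> 2 * r"
          using True \<open>\<rho> > 0\<close> by (auto simp: s_def)
        have "(1 - \<rho>) * (1 + min 1 \<rho>) < 1"
        proof (cases "\<rho> < 1")
          case True
          then show ?thesis
            using \<open>\<rho> > 0\<close> by (simp add: algebra_simps)
        qed simp
        then have "(1 - \<rho>) * s < r"
          using mult_strict_left_mono[OF _ True] by (fastforce simp: s_def mult.left_commute)
        \<comment> \<open>Since \<open>r\<close> is the supremum of the distances, some
          \<open>C i\<close> lies farther from \<open>y\<close> than the shrunken ball
          reaches.\<close>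
        then obtain i where i: "i \<in> I" "(1 - \<rho>) * s < d i"
          using less_cSUP_iff[OF _ bdd] i0 unfolding r_def by blast
        have "C i \<inter> cball y s \<in> F"
          using i(1) s(1) by (rule F_I)
        moreover have "\<exists>k. finite k \<and> C i \<inter> cball y s \<subseteq> (\<Union>c\<in>k. ball c e)"
        \<comment> \<open>The separated alternative is contradictory: the closed hull of the
          sequence stays in the closed convex set \<open>C i\<close>, yet near uniform convexity
          makes it meet the shrunken ball.\<close>
        proof (rule separated_sequence_or_finite_cover)
          fix x :: "nat \<Rightarrow> 'a"
          assume x: "range x \<subseteq> C i \<inter> cball y s" "separated_family e UNIV x"
          then have "\<forall>n. dist (x n) y \<le> s"
            by (auto simp: image_subset_iff dist_commute)
          with \<rho> s(2) x(2) obtain z where "dist y z \<le> (1 - \<rho>) * s"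
            and z: "z \<in> closure (geodesic_hull (range x))"
            by (metis Int_emptyI mem_cball)
          moreover have "closure (geodesic_hull (range x)) \<subseteq> C i"
            using C i(1) x(1) by (intro closure_minimal geodesic_hull_subset) auto
          ultimately have "d i \<le> (1 - \<rho>) * s"
            unfolding d_def using infdist_le[of z "C i" y] by auto
          with i(2) show ?thesis
            by simp
        qed blast
        ultimately show ?thesis
          by blast
      qed
    qed
    then obtain p where p: "\<And>A. A \<in> F \<Longrightarrow> p \<in> A"
      by blast
    have "p \<in> C i" if "i \<in> I" for i
      using p[OF F_I[of i "r + 1"]] that by simp
    then show ?thesis
      by blast
  qed
qed

end
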